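(* Let $0<q<1$ be fixed. Suppose $\{d_n(q;q)_n\}_{n\ge0}$ is a doubly positive sequence, let $$d(\mu;x)=\sum_{n=0}^{\infty}d_n\Gamma_q(\mu+n)x^n$$ with radius of convergence $R_d>0$, and let $$\Delta_d(\alpha,\beta;x)=d(\mu+\alpha;x)d(\mu+\beta;x)-d(\mu;x)d(\mu+\alpha+\beta;x).$$ Then for all $\mu,\alpha,\beta>0$ and $0\le x<R_d$ the following estimates hold: $$\frac{\Gamma_q(\mu+\alpha)\Gamma_q(\mu+\beta)}{\Gamma_q(\mu)\Gamma_q(\mu+\alpha+\beta)}\le\frac{d(\mu+\alpha;x)d(\mu+\beta;x)}{d(\mu;x)d(\mu+\alpha+\beta;x)}<1 \qquad(\mathrm{A})$$ and $$\left[\frac{\Gamma_q(\mu+\alpha)\Gamma_q(\mu+\beta)}{\Gamma_q(\mu)\Gamma_q(\mu+\alpha+\beta)}-1\right]d(\mu;x)d(\mu+\alpha+\beta;x)\le\Delta_d(\alpha,\beta;x)\le d_0^2\left[\Gamma_q(\mu+\alpha)\Gamma_q(\mu+\beta)-\Gamma_q(\mu)\Gamma_q(\mu+\alpha+\beta)\right], \qquad(\mathrm{B})$$ with equality only at $x=0$. The upper bounds in both (A) and (B) remain valid if $\{d_n\}_{n\ge0}$ is any non-negative sequence.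
   Context: For $0<q<1$: $(a;q)_0=1$, $(a;q)_n=\prod_{k=0}^{n-1}(1-aq^k)$ for $n\ge1$, $(a;q)_\infty=\lim_{n\to\infty}(a;q)_n$, and the $q$-gamma function is $\Gamma_q(z)=(1-q)^{1-z}\dfrac{(q;q)_\infty}{(q^z;q)_\infty}$. A sequence $\{f_n\}_{n\ge0}$ of nonnegative reals is doubly positive if it is nontrivial (not identically zero), is log-concave ($f_k^2\ge f_{k-1}f_{k+1}$ for all $k\ge1$), and has no internal zeros ($f_N=0$ implies that either $f_{N+i}=0$ for all $i\ge0$, or $f_{N-i}=0$ for $i=0,\dots,N$).
   Formalization: "Equality only at x=0" is proved when some d_n with n≥1 is nonzero (for d=(1,0,0,...) equality holds for all x); (A) is asserted only where its middle quotient is defined, i.e. not at x=0 with d_0=0, nor for d identically zero. *)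

theory Defs
  imports "HOL-Analysis.Analysis"
begin

definition qpoch :: "real \<Rightarrow> real \<Rightarrow> nat \<Rightarrow> real" where
  "qpoch a q n = (\<Prod>k<n. 1 - a * q ^ k)"

definition qpoch_inf :: "real \<Rightarrow> real \<Rightarrow> real" where
  "qpoch_inf a q = lim (\<lambda>n. qpoch a q n)"

definition q_Gamma :: "real \<Rightarrow> real \<Rightarrow> real" where
  "q_Gamma q z = (1 - q) powr (1 - z) * (qpoch_inf q q / qpoch_inf (q powr z) q)"

definition log_concave_seq :: "(nat \<Rightarrow> real) \<Rightarrow> bool" where
  "log_concave_seq f \<longleftrightarrow> (\<forall>k\<ge>1. (f k)\<^sup>2 \<ge> f (k - 1) * f (k + 1))"

definition no_internal_zeros :: "(nat \<Rightarrow> real) \<Rightarrow> bool" where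
  "no_internal_zeros f \<longleftrightarrow>
     (\<forall>N. f N = 0 \<longrightarrow> (\<forall>i. f (N + i) = 0) \<or> (\<forall>i\<le>N. f (N - i) = 0))"

definition doubly_positive :: "(nat \<Rightarrow> real) \<Rightarrow> bool" where
  "doubly_positive f \<longleftrightarrow>
     (\<forall>n. f n \<ge> 0) \<and> (\<exists>n. f n \<noteq> 0) \<and> log_concave_seq f \<and> no_internal_zeros f"

definition dser :: "real \<Rightarrow> (nat \<Rightarrow> real) \<Rightarrow> real \<Rightarrow> real \<Rightarrow> real" where
  "dser q d \<mu> x = (\<Sum>n. d n * q_Gamma q (\<mu> + real n) * x ^ n)"

(* The radius does not depend on \<mu> > 0, since q_Gamma q (\<mu> + n) * (1 - q) ^ n has a
   positive finite limit as n tends to infinity. It may be infinite. *)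
definition dser_radius :: "real \<Rightarrow> (nat \<Rightarrow> real) \<Rightarrow> real \<Rightarrow> ereal" where
  "dser_radius q d \<mu> = conv_radius (\<lambda>n. d n * q_Gamma q (\<mu> + real n))"

definition Delta :: "real \<Rightarrow> (nat \<Rightarrow> real) \<Rightarrow> real \<Rightarrow> real \<Rightarrow> real \<Rightarrow> real \<Rightarrow> real" where
  "Delta q d \<mu> \<alpha> \<beta> x =
     dser q d (\<mu> + \<alpha>) x * dser q d (\<mu> + \<beta>) x - dser q d \<mu> x * dser q d (\<mu> + \<alpha> + \<beta>) x"

definition Gamma_quot :: "real \<Rightarrow> real \<Rightarrow> real \<Rightarrow> real \<Rightarrow> real" where
  "Gamma_quot q \<mu> \<alpha> \<beta> =
     (q_Gamma q (\<mu> + \<alpha>) * q_Gamma q (\<mu> + \<beta>)) / (q_Gamma q \<mu> * q_Gamma q (\<mu> + \<alpha> + \<beta>))"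

definition dser_quot :: "real \<Rightarrow> (nat \<Rightarrow> real) \<Rightarrow> real \<Rightarrow> real \<Rightarrow> real \<Rightarrow> real \<Rightarrow> real" where
  "dser_quot q d \<mu> \<alpha> \<beta> x =
     (dser q d (\<mu> + \<alpha>) x * dser q d (\<mu> + \<beta>) x) / (dser q d \<mu> x * dser q d (\<mu> + \<alpha> + \<beta>) x)"

definition lower_B :: "real \<Rightarrow> (nat \<Rightarrow> real) \<Rightarrow> real \<Rightarrow> real \<Rightarrow> real \<Rightarrow> real \<Rightarrow> real" where
  "lower_B q d \<mu> \<alpha> \<beta> x =
     (Gamma_quot q \<mu> \<alpha> \<beta> - 1) * dser q d \<mu> x * dser q d (\<mu> + \<alpha> + \<beta>) x"

definition upper_B :: "real \<Rightarrow> (nat \<Rightarrow> real) \<Rightarrow> real \<Rightarrow> real \<Rightarrow> real \<Rightarrow> real" where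
  "upper_B q d \<mu> \<alpha> \<beta> =
     (d 0)\<^sup>2 * (q_Gamma q (\<mu> + \<alpha>) * q_Gamma q (\<mu> + \<beta>)
                - q_Gamma q \<mu> * q_Gamma q (\<mu> + \<alpha> + \<beta>))"

(* For a nontrivial nonnegative d this says exactly that the denominator in dser_quot is
   nonzero: it vanishes only at x = 0 when d 0 = 0, where the quotient would be 0/0. *)
definition quot_defined :: "(nat \<Rightarrow> real) \<Rightarrow> real \<Rightarrow> bool" where
  "quot_defined d x \<longleftrightarrow> x > 0 \<or> d 0 \<noteq> 0"

(* If d vanishes beyond d 0, both sides of each non-strict estimate coincide for all x,
   so the equality discussion needs some nonzero term of positive index. *)
definition nonconstant :: "(nat \<Rightarrow> real) \<Rightarrow> bool" where
  "nonconstant d \<longleftrightarrow> (\<exists>n\<ge>1. d n \<noteq> 0)"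

end

theory Submission
  imports Defs
begin

text \<open>
  For the lower bounds, factor \<open>d(\<mu>;x) = \<Gamma>\<^sub>q(\<mu>) F(q\<^sup>\<mu>)\<close> with
  \<open>F(a) = \<Sum> e\<^sub>n [a]\<^sub>n y\<^sup>n\<close>, \<open>e\<^sub>n = d\<^sub>n (q;q)\<^sub>n\<close>, \<open>[a]\<^sub>n = (a;q)\<^sub>n / (q;q)\<^sub>n\<close>, \<open>y = x/(1-q)\<close>.
  Expanding \<open>[au]\<^sub>k\<close> and \<open>[auv]\<^sub>l\<close> by the q-Vandermonde identity turns
  \<open>F(au) F(av) - F(a) F(auv)\<close> into a positive combination (over \<open>i\<close>) of sums of
  \<open>[a]\<^sub>k [av]\<^sub>l (e\<^bsub>k+i\<^esub> e\<^sub>l - v\<^sup>i e\<^sub>k e\<^bsub>l+i\<^esub>)\<close> over \<open>k + l\<close> fixed. Replacing \<open>v\<^sup>i\<close> by 1 only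
  decreases them, and makes the bracket antisymmetric in \<open>k, l\<close>; its sign (log-concavity of \<open>e\<close>)
  agrees with that of \<open>[a]\<^sub>k [av]\<^sub>l - [a]\<^sub>l [av]\<^sub>k\<close>.

  The upper bounds rest on \<open>\<Gamma>\<^sub>q(x+\<alpha>) \<Gamma>\<^sub>q(x+\<beta>) \<le> \<Gamma>\<^sub>q(x) \<Gamma>\<^sub>q(x+\<alpha>+\<beta>)\<close>, which holds factor by factor
  in the infinite products: pairing the terms \<open>(k, l)\<close> and \<open>(l, k)\<close> shows that all coefficients of
  \<open>\<Delta>\<^sub>d\<close> are nonpositive, and its constant term is the bound.
\<close>

section \<open>Finite q-shifted factorials and the q-Vandermonde identity\<close>

text \<open>By the q-binomial theorem, these are the coefficients of \<open>z ^ n\<close> in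
  (az;q)_inf / (z;q)_inf.\<close>

definition qcoeff :: "real \<Rightarrow> real \<Rightarrow> nat \<Rightarrow> real" where
  "qcoeff q a n = qpoch a q n / qpoch q q n"

lemma qpoch_0 [simp]: "qpoch a q 0 = 1"
  by (simp add: qpoch_def)

lemma qpoch_Suc: "qpoch a q (Suc n) = qpoch a q n * (1 - a * q ^ n)"
  by (simp add: qpoch_def)

lemma qpoch_add: "qpoch a q (m + n) = qpoch a q m * qpoch (a * q ^ m) q n"
  by (induction n) (simp_all add: qpoch_Suc power_add mult_ac)

lemma mult_power_less_one:
  fixes a q :: real
  assumes "0 < q" "q < 1" "0 < a" "a < 1"
  shows "a * q ^ n < 1"
proof -
  have "a * q ^ n \<le> a * 1"
    using assms by (intro mult_left_mono power_le_one) auto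
  with assms show ?thesis by linarith
qed

lemma qpoch_pos:
  assumes "0 < q" "q < 1" "0 < a" "a < 1"
  shows "qpoch a q n > 0"
  unfolding qpoch_def using mult_power_less_one[OF assms] by (intro prod_pos) (simp add: algebra_simps)

lemma qcoeff_0 [simp]: "qcoeff q a 0 = 1"
  by (simp add: qcoeff_def)

lemma qcoeff_pos:
  assumes "0 < q" "q < 1" "0 < a" "a < 1"
  shows "qcoeff q a n > 0"
  using assms by (simp add: qcoeff_def qpoch_pos)

lemma qcoeff_Suc:
  assumes "0 < q" "q < 1"
  shows "(1 - q ^ Suc n) * qcoeff q a (Suc n) = (1 - a * q ^ n) * qcoeff q a n"
proof -
  have "q * q ^ n < 1"
    using assms by (simp add: mult_power_less_one)
  moreover have "qpoch q q n > 0"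
    using assms by (simp add: qpoch_pos)
  ultimately show ?thesis
    by (simp add: qcoeff_def qpoch_Suc field_simps)
qed

text \<open>In generating functions: (auz)_inf/(z)_inf is the product of (auz)_inf/(az)_inf and
  (az)_inf/(z)_inf. The proof avoids series: it multiplies by \<open>1 - q ^ Suc n\<close> and uses
  the recurrence \<open>qcoeff_Suc\<close> on either factor.\<close>

lemma qcoeff_q_Vandermonde:
  assumes "0 < q" "q < 1"
  shows "qcoeff q (a * u) n = (\<Sum>i\<le>n. a ^ i * qcoeff q u i * qcoeff q a (n - i))"
proof (induction n)
  case (Suc n)
  define c where "c i = a ^ i * qcoeff q u i * qcoeff q a (Suc n - i)" for i
  \<comment> \<open>The first part lowers the index of \<open>qcoeff q a\<close>, the second that of
    \<open>qcoeff q u\<close>.\<close>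
  have split: "1 - q ^ Suc n = (1 - q ^ (Suc n - i)) + q ^ (Suc n - i) * (1 - q ^ i)"
    if "i \<le> Suc n" for i
    using that by (simp add: algebra_simps flip: power_add)
  have "(1 - q ^ Suc n) * (\<Sum>i\<le>Suc n. c i) =
      (\<Sum>i\<le>Suc n. (1 - q ^ (Suc n - i)) * c i) + (\<Sum>i\<le>Suc n. q ^ (Suc n - i) * (1 - q ^ i) * c i)"
    unfolding sum_distrib_left sum.distrib[symmetric]
    by (intro sum.cong refl) (subst split, auto simp: algebra_simps)
  \<comment> \<open>The term \<open>i = Suc n\<close> carries the factor \<open>1 - q ^ 0\<close>
    and drops out; in the second sum the same happens to \<open>i = 0\<close>.\<close>
  also have "(\<Sum>i\<le>Suc n. (1 - q ^ (Suc n - i)) * c i) =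
      (\<Sum>i\<le>n. (1 - q ^ Suc (n - i)) * c i)"
    by (simp add: Suc_diff_le)
  also have "\<dots> = (\<Sum>i\<le>n. a ^ i * qcoeff q u i * ((1 - a * q ^ (n - i)) * qcoeff q a (n - i)))"
  proof (intro sum.cong refl)
    fix i assume "i \<in> {..n}"
    then have "c i = a ^ i * qcoeff q u i * qcoeff q a (Suc (n - i))"
      by (simp add: c_def Suc_diff_le)
    then show "(1 - q ^ Suc (n - i)) * c i =
        a ^ i * qcoeff q u i * ((1 - a * q ^ (n - i)) * qcoeff q a (n - i))"
      using qcoeff_Suc[OF assms, of "n - i" a] by (metis mult.left_commute)
  qed
  also have "(\<Sum>i\<le>Suc n. q ^ (Suc n - i) * (1 - q ^ i) * c i) =
      (\<Sum>i\<le>n. q ^ (n - i) * ((1 - q ^ Suc i) * c (Suc i)))"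
    by (subst sum.atMost_Suc_shift) (simp add: mult.assoc)
  also have "\<dots> = (\<Sum>i\<le>n. q ^ (n - i) * a ^ Suc i * ((1 - u * q ^ i) * qcoeff q u i) * qcoeff q a (n - i))"
  proof (intro sum.cong refl)
    fix i assume "i \<in> {..n}"
    have "c (Suc i) = a ^ Suc i * qcoeff q u (Suc i) * qcoeff q a (n - i)"
      by (simp add: c_def)
    then have "q ^ (n - i) * ((1 - q ^ Suc i) * c (Suc i)) = q ^ (n - i) * a ^ Suc i *
        ((1 - q ^ Suc i) * qcoeff q u (Suc i)) * qcoeff q a (n - i)"
      by (simp only: mult_ac)
    then show "q ^ (n - i) * ((1 - q ^ Suc i) * c (Suc i)) =
        q ^ (n - i) * a ^ Suc i * ((1 - u * q ^ i) * qcoeff q u i) * qcoeff q a (n - i)"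
      by (simp only: qcoeff_Suc[OF assms])
  qed
  \<comment> \<open>Termwise, (1 - a q^(n-i)) + a q^(n-i) (1 - u q^i) = 1 - a u q^n, which is
    independent of \<open>i\<close>.\<close>
  also have "(\<Sum>i\<le>n. a ^ i * qcoeff q u i * ((1 - a * q ^ (n - i)) * qcoeff q a (n - i))) + \<dots> =
      (1 - a * u * q ^ n) * (\<Sum>i\<le>n. a ^ i * qcoeff q u i * qcoeff q a (n - i))"
    unfolding sum_distrib_left sum.distrib[symmetric]
  proof (intro sum.cong refl)
    fix i assume "i \<in> {..n}"
    then have "q ^ n = q ^ (n - i) * q ^ i"
      by (simp flip: power_add)
    then show "a ^ i * qcoeff q u i * ((1 - a * q ^ (n - i)) * qcoeff q a (n - i)) +
        q ^ (n - i) * a ^ Suc i * ((1 - u * q ^ i) * qcoeff q u i) * qcoeff q a (n - i) =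
        (1 - a * u * q ^ n) * (a ^ i * qcoeff q u i * qcoeff q a (n - i))"
      by (simp add: algebra_simps)
  qed
  also have "\<dots> = (1 - q ^ Suc n) * qcoeff q (a * u) (Suc n)"
    by (simp only: qcoeff_Suc[OF assms] Suc.IH)
  finally have "(1 - q ^ Suc n) * (\<Sum>i\<le>Suc n. c i) = (1 - q ^ Suc n) * qcoeff q (a * u) (Suc n)" .
  moreover have "1 - q ^ Suc n \<noteq> 0"
    using power_Suc_less_one[of q n] assms by simp
  ultimately show ?case
    by (simp add: c_def)
qed simp

section \<open>Cross inequalities for the coefficients and for log-concave sequences\<close>

text \<open>The ratio of \<open>qcoeff q (a * v) n\<close> to \<open>qcoeff q a n\<close> is
  nondecreasing in \<open>n\<close>: each step multiplies it by (1 - a v q^n) / (1 - a q^n), which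
  is at least 1.\<close>

lemma qcoeff_cross_mono:
  assumes "0 < q" "q < 1" "0 < a" "a < 1" "0 < v" "v < 1" "k \<le> l"
  shows "qcoeff q a l * qcoeff q (a * v) k \<le> qcoeff q a k * qcoeff q (a * v) l"
  using \<open>k \<le> l\<close>
proof (induction l rule: dec_induct)
  case (step l)
  have av: "0 < a * v" "a * v < a" "a * v < 1"
    using assms mult_strict_mono[of a 1 v 1] by auto
  have 1: "0 < 1 - a * q ^ l" "1 - a * q ^ l \<le> 1 - a * v * q ^ l"
    using assms av mult_power_less_one[of q a l] by (auto intro!: mult_right_mono)
  have 2: "qcoeff q b (Suc l) = qcoeff q b l * ((1 - b * q ^ l) / (1 - q * q ^ l))" for b
    by (simp add: qcoeff_def qpoch_Suc)
  have 3: "1 - q * q ^ l > 0"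
    using assms mult_power_less_one[of q q l] by simp
  have "qcoeff q a (Suc l) * qcoeff q (a * v) k =
      (qcoeff q a l * qcoeff q (a * v) k) * ((1 - a * q ^ l) / (1 - q * q ^ l))"
    by (simp add: 2)
  also have "\<dots> \<le> (qcoeff q a k * qcoeff q (a * v) l) * ((1 - a * v * q ^ l) / (1 - q * q ^ l))"
    using assms av 1 3
    by (intro mult_mono[OF step.IH] divide_right_mono mult_nonneg_nonneg divide_nonneg_pos
        less_imp_le[OF qcoeff_pos]) auto
  also have "\<dots> = qcoeff q a k * qcoeff q (a * v) (Suc l)"
    by (simp add: 2)
  finally show ?case .
qed simp

text \<open>Log-concavity makes the ratios of consecutive terms nonincreasing; the absence of
  internal zeros covers the places where such a ratio is undefined.\<close>

lemma doubly_positive_cross: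
  assumes "doubly_positive e" "k \<le> l"
  shows "e k * e (l + i) \<le> e (k + i) * e l"
proof -
  have nn: "e n \<ge> 0" for n
    using assms by (simp add: doubly_positive_def)
  have lc: "e l * e (Suc (Suc l)) \<le> e (Suc l) * e (Suc l)" for l
    using assms unfolding doubly_positive_def log_concave_seq_def power2_eq_square
    by (metis One_nat_def Suc_eq_plus1 diff_Suc_1 le_add2)
  have zero: "e k = 0 \<or> e (l + j) = 0" if "e l = 0" "k \<le> l" for k l j
    using assms that unfolding doubly_positive_def no_internal_zeros_def
    by (metis diff_diff_cancel diff_le_self)
  \<comment> \<open>The case \<open>i = 1\<close>. If \<open>e l\<close> vanishes, cancelling it is
    impossible, but then \<open>zero\<close> kills the left-hand side.\<close>
  have step: "e k * e (Suc l) \<le> e (Suc k) * e l" if "k \<le> l" for k l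
    using that
  proof (induction l rule: dec_induct)
    case (step l)
    show ?case
    proof (cases "e l = 0")
      case True
      then show ?thesis
        using zero[OF True step.hyps(1), of 2] nn by auto
    next
      case False
      have "e l * (e k * e (Suc (Suc l))) = e k * (e l * e (Suc (Suc l)))"
        by (simp add: mult_ac)
      also have "\<dots> \<le> e k * (e (Suc l) * e (Suc l))"
        by (intro mult_left_mono lc nn)
      also have "\<dots> \<le> (e (Suc k) * e l) * e (Suc l)"
        using step.IH nn by (simp add: mult_right_mono flip: mult.assoc)
      finally have "e l * (e k * e (Suc (Suc l))) \<le> e l * (e (Suc k) * e (Suc l))"
        by (simp add: mult_ac)
      with False nn[of l] show ?thesis
        by simp
    qed
  qed (simp add: mult.commute)
  show ?thesis
    using \<open>k \<le> l\<close>
  proof (induction i arbitrary: k)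
    case (Suc i)
    show ?case
    proof (cases "k = l")
      case False
      \<comment> \<open>One unit moves from the larger index to the smaller;
        \<open>k \<noteq> l\<close> keeps \<open>Suc k \<le> l\<close> for the induction
        hypothesis.\<close>
      have "e k * e (l + Suc i) \<le> e (Suc k) * e (l + i)"
        using step[of k "l + i"] Suc.prems by simp
      also have "\<dots> \<le> e (Suc k + i) * e l"
        using Suc.IH[of "Suc k"] False Suc.prems by simp
      finally show ?thesis by simp
    qed (simp add: mult.commute)
  qed simp
qed

section \<open>Convolution coefficients behind the lower bounds\<close>

lemma sum_atMost_rev:
  fixes f :: "nat \<Rightarrow> 'a::comm_monoid_add"
  shows "(\<Sum>k\<le>n. f (n - k)) = (\<Sum>k\<le>n. f k)"
  by (rule sum.reindex_bij_witness[of _ "\<lambda>k. n - k" "\<lambda>k. n - k"]) auto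

text \<open>Adding the sum to its reversal gives twice its value, with terms that are nonnegative
  one by one.\<close>

lemma sum_antisym_nonneg:
  fixes p V :: "nat \<Rightarrow> real"
  assumes anti: "\<And>k. k \<le> n \<Longrightarrow> V (n - k) = - V k"
    and sgn: "\<And>k. k \<le> n \<Longrightarrow> (p k - p (n - k)) * V k \<ge> 0"
  shows "(\<Sum>k\<le>n. p k * V k) \<ge> 0"
proof -
  have "(\<Sum>k\<le>n. p k * V k) = (\<Sum>k\<le>n. p (n - k) * V (n - k))"
    by (rule sum_atMost_rev[symmetric])
  also have "\<dots> = - (\<Sum>k\<le>n. p (n - k) * V k)"
    by (simp add: anti sum_negf)
  finally have "2 * (\<Sum>k\<le>n. p k * V k) = (\<Sum>k\<le>n. (p k - p (n - k)) * V k)"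
    by (simp add: algebra_simps sum_subtractf)
  also have "\<dots> \<ge> 0"
    by (intro sum_nonneg sgn) simp
  finally show ?thesis by simp
qed

lemma sum_triangle:
  fixes f :: "nat \<Rightarrow> nat \<Rightarrow> 'a::comm_monoid_add"
  shows "(\<Sum>k\<le>m. \<Sum>i\<le>k. f i (k - i)) = (\<Sum>i\<le>m. \<Sum>j\<le>m - i. f i j)"
proof -
  have "(\<Sum>k\<le>m. \<Sum>i\<le>k. f i (k - i)) = (\<Sum>(i, j)\<in>{(i, j). i + j \<le> m}. f i j)"
    by (rule sum.triangle_reindex_eq[symmetric])
  also have "{(i, j). i + j \<le> m} = (SIGMA i:{..m}. {..m - i})"
    by auto
  finally show ?thesis
    by (simp add: sum.Sigma)
qed

text \<open>Both \<open>a * u\<close> and \<open>a * u * v\<close> are expanded by splitting off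
  \<open>u\<close>, from \<open>a\<close> and from \<open>a * v\<close> respectively. The expansions
  share \<open>a ^ i * qcoeff q u i\<close>, the second with an extra \<open>v ^ i\<close>, and
  leave the same product of coefficients behind.\<close>

lemma qcoeff_convolution_diff:
  assumes "0 < q" "q < 1"
  shows "(\<Sum>k\<le>m. e k * e (m - k) * (qcoeff q (a * u) k * qcoeff q (a * v) (m - k)
            - qcoeff q a k * qcoeff q (a * u * v) (m - k))) =
    (\<Sum>i\<le>m. a ^ i * qcoeff q u i * (\<Sum>k\<le>m - i. qcoeff q a k * qcoeff q (a * v) (m - i - k) *
        (e (k + i) * e (m - i - k) - v ^ i * e k * e (m - k))))"
proof -
  define b c where "b = qcoeff q a" and "c = qcoeff q (a * v)"
  have "(\<Sum>k\<le>m. e k * e (m - k) * (qcoeff q (a * u) k * c (m - k))) =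
      (\<Sum>k\<le>m. \<Sum>i\<le>k. e (i + (k - i)) * e (m - i - (k - i)) * (a ^ i * qcoeff q u i * b (k - i) * c (m - i - (k - i))))"
    by (simp add: qcoeff_q_Vandermonde[OF assms, of a u] b_def sum_distrib_left sum_distrib_right mult_ac)
  also have "\<dots> = (\<Sum>i\<le>m. \<Sum>k\<le>m - i. e (i + k) * e (m - i - k) * (a ^ i * qcoeff q u i * b k * c (m - i - k)))"
    by (rule sum_triangle)
  finally have 1: "(\<Sum>k\<le>m. e k * e (m - k) * (qcoeff q (a * u) k * c (m - k))) = \<dots>" .
  \<comment> \<open>Reversal gives the factor to be expanded the index \<open>k\<close>, as
    \<open>sum_triangle\<close> requires; the inner sums are reversed back at the end.\<close>
  have "(\<Sum>k\<le>m. e k * e (m - k) * (b k * qcoeff q (a * u * v) (m - k))) =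
      (\<Sum>k\<le>m. e (m - k) * e k * (b (m - k) * qcoeff q (a * v * u) k))"
    by (subst sum_atMost_rev[symmetric]) (simp add: mult_ac)
  also have "\<dots> = (\<Sum>k\<le>m. \<Sum>i\<le>k. e (m - i - (k - i)) * e (i + (k - i)) *
      (b (m - i - (k - i)) * ((a * v) ^ i * qcoeff q u i * c (k - i))))"
    by (simp add: qcoeff_q_Vandermonde[OF assms, of "a * v" u] c_def sum_distrib_left)
  also have "\<dots> = (\<Sum>i\<le>m. \<Sum>k\<le>m - i. e (m - i - k) * e (i + k) *
      (b (m - i - k) * ((a * v) ^ i * qcoeff q u i * c k)))"
    by (rule sum_triangle)
  also have "\<dots> = (\<Sum>i\<le>m. \<Sum>k\<le>m - i. e k * e (m - k) * (b k * ((a * v) ^ i * qcoeff q u i * c (m - i - k))))"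
  proof (rule sum.cong[OF refl])
    fix i assume "i \<in> {..m}"
    then show "(\<Sum>k\<le>m - i. e (m - i - k) * e (i + k) * (b (m - i - k) * ((a * v) ^ i * qcoeff q u i * c k))) =
        (\<Sum>k\<le>m - i. e k * e (m - k) * (b k * ((a * v) ^ i * qcoeff q u i * c (m - i - k))))"
      by (subst sum_atMost_rev[symmetric]) (intro sum.cong, auto)
  qed
  finally have 2: "(\<Sum>k\<le>m. e k * e (m - k) * (b k * qcoeff q (a * u * v) (m - k))) = \<dots>" .
  show ?thesis
    unfolding right_diff_distrib sum_subtractf 1[unfolded b_def c_def] 2[unfolded b_def c_def]
    by (simp add: sum_distrib_left power_mult_distrib mult_ac add_ac)
qed

text \<open>The strict part comes from the amount lost when \<open>v ^ i\<close> is replaced by 1,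
  which is positive for \<open>i = p\<close> if \<open>e p\<close> is.\<close>

lemma qcoeff_convolution_diff_nonneg:
  assumes q: "0 < q" "q < 1" and a: "0 < a" "a < 1" and u: "0 < u" "u < 1" and v: "0 < v" "v < 1"
    and e: "doubly_positive e"
  defines "C \<equiv> \<lambda>m. \<Sum>k\<le>m. e k * e (m - k) * (qcoeff q (a * u) k * qcoeff q (a * v) (m - k)
            - qcoeff q a k * qcoeff q (a * u * v) (m - k))"
  shows "C m \<ge> 0" and "p \<ge> 1 \<Longrightarrow> e p \<noteq> 0 \<Longrightarrow> C (2 * p) > 0"
proof -
  have av: "0 < a * v" "a * v < 1"
    using a v mult_strict_mono[of a 1 v 1] by auto
  have nn: "e n \<ge> 0" for n
    using e by (simp add: doubly_positive_def)
  define b c where "b = qcoeff q a" and "c = qcoeff q (a * v)"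
  have b: "b n > 0" and c: "c n > 0" for n
    using q a av by (simp_all add: b_def c_def qcoeff_pos)
  have cross: "b l * c k \<le> b k * c l" if "k \<le> l" for k l
    using qcoeff_cross_mono[OF q a v that] by (simp add: b_def c_def)
  \<comment> \<open>\<open>I\<close> is the inner sum of \<open>qcoeff_convolution_diff\<close>, and
    \<open>R\<close> is the exact loss: \<open>I n i - R n i\<close> is the sum with the
    antisymmetric bracket.\<close>
  define R where "R n i = (1 - v ^ i) * (\<Sum>k\<le>n. b k * c (n - k) * (e k * e (n - k + i)))" for n i
  define I where "I n i = (\<Sum>k\<le>n. b k * c (n - k) * (e (k + i) * e (n - k) - v ^ i * e k * e (n - k + i)))" for n i
  have vi: "v ^ i \<le> 1" for i
    using v by (simp add: power_le_one)
  have R: "R n i \<ge> 0" for n i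
    unfolding R_def using vi[of i] by (intro mult_nonneg_nonneg sum_nonneg less_imp_le[OF b] less_imp_le[OF c] nn) auto
  have I: "R n i \<le> I n i" for n i
  proof -
    have "0 \<le> (\<Sum>k\<le>n. (b k * c (n - k)) * (e (k + i) * e (n - k) - e k * e (n - k + i)))"
    proof (rule sum_antisym_nonneg)
      fix k assume "k \<le> n"
      show "(b k * c (n - k) - b (n - k) * c (n - (n - k))) *
          (e (k + i) * e (n - k) - e k * e (n - k + i)) \<ge> 0"
      proof (cases "k \<le> n - k")
        case True
        then show ?thesis
          using cross[of k "n - k"] doubly_positive_cross[OF e, of k "n - k" i] \<open>k \<le> n\<close>
          by (intro mult_nonneg_nonneg) auto
      next
        case False
        then show ?thesis
          using cross[of "n - k" k] doubly_positive_cross[OF e, of "n - k" k i] \<open>k \<le> n\<close>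
          by (intro mult_nonpos_nonpos) (auto simp: mult.commute)
      qed
    qed (simp add: mult.commute)
    also have "\<dots> = I n i - R n i"
      unfolding I_def R_def sum_distrib_left sum_subtractf[symmetric]
      by (intro sum.cong) (auto simp: algebra_simps)
    finally show ?thesis by simp
  qed
  have C: "C m = (\<Sum>i\<le>m. a ^ i * qcoeff q u i * I (m - i) i)" for m
    unfolding C_def qcoeff_convolution_diff[OF q] I_def b_def c_def
    by (intro sum.cong refl arg_cong2[of _ _ _ _ "(*)"]) auto
  have pos: "a ^ i * qcoeff q u i > 0" for i
    using a qcoeff_pos[OF q u] by simp
  have nonneg: "a ^ i * qcoeff q u i * I n i \<ge> 0" for i n
    using pos[of i] order_trans[OF R I] by (intro mult_nonneg_nonneg[of "a ^ i * qcoeff q u i"]) auto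
  show "C m \<ge> 0"
    unfolding C by (intro sum_nonneg nonneg)
  assume p: "p \<ge> 1" "e p \<noteq> 0"
  have "e p > 0"
    using p nn[of p] by simp
  moreover have "v ^ p < 1"
    using v p by (simp add: power_less_one_iff)
  \<comment> \<open>The summand \<open>k = p\<close> contains \<open>e p * e p\<close>.\<close>
  ultimately have "0 < R p p"
    unfolding R_def
    by (intro mult_pos_pos sum_pos2[of _ p] mult_nonneg_nonneg less_imp_le[OF b] less_imp_le[OF c] nn b c) auto
  then show "C (2 * p) > 0"
    unfolding C using I[of p p] pos[of p] nonneg
    by (intro sum_pos2[of _ p]) auto
qed

section \<open>Infinite q-products\<close>

text \<open>The product converges absolutely and has no zero factor, so its limit is nonzero;
  positive partial products then fix the sign.\<close>

lemma qpoch_inf: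
  assumes "0 < q" "q < 1" "0 < a" "a < 1"
  shows qpoch_LIMSEQ: "qpoch a q \<longlonglongrightarrow> qpoch_inf a q"
    and qpoch_inf_pos: "qpoch_inf a q > 0"
proof -
  have "summable (\<lambda>k. norm ((1 - a * q ^ k) - 1))"
    using assms by (simp add: abs_mult summable_mult summable_geometric)
  then have "convergent_prod (\<lambda>k. 1 - a * q ^ k)"
    using abs_convergent_prod_conv_summable abs_convergent_prod_imp_convergent_prod by blast
  moreover have "1 - a * q ^ k \<noteq> 0" for k
    using mult_power_less_one[OF assms, of k] by simp
  \<comment> \<open>The shift to \<open>Suc n\<close> matches the closed ranges \<open>{..n}\<close>
    in the library's partial products.\<close>
  ultimately have "convergent (\<lambda>n. qpoch a q (Suc n))" and nz: "lim (\<lambda>n. qpoch a q (Suc n)) \<noteq> 0"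
    by (simp_all add: convergent_prod_iff_convergent qpoch_def lessThan_Suc_atMost)
  then have "convergent (qpoch a q)"
    using convergent_Suc_iff by blast
  then show lim: "qpoch a q \<longlonglongrightarrow> qpoch_inf a q"
    unfolding qpoch_inf_def by (simp add: convergent_LIMSEQ_iff)
  then have "lim (\<lambda>n. qpoch a q (Suc n)) = qpoch_inf a q"
    by (intro limI) (simp add: LIMSEQ_Suc)
  moreover have "qpoch_inf a q \<ge> 0"
    using lim by (rule LIMSEQ_le_const) (use qpoch_pos[OF assms] in \<open>auto intro: less_imp_le\<close>)
  ultimately show "qpoch_inf a q > 0"
    using nz by simp
qed

lemma qpoch_inf_split:
  assumes "0 < q" "q < 1" "0 < a" "a < 1"
  shows "qpoch_inf a q = qpoch a q n * qpoch_inf (a * q ^ n) q"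
proof -
  have "qpoch (a * q ^ n) q \<longlonglongrightarrow> qpoch_inf (a * q ^ n) q"
    using assms by (intro qpoch_LIMSEQ mult_power_less_one) auto
  then have "(\<lambda>m. qpoch a q (n + m)) \<longlonglongrightarrow> qpoch a q n * qpoch_inf (a * q ^ n) q"
    unfolding qpoch_add by (intro tendsto_intros)
  moreover have "(\<lambda>m. qpoch a q (n + m)) \<longlonglongrightarrow> qpoch_inf a q"
    using LIMSEQ_ignore_initial_segment[OF qpoch_LIMSEQ[OF assms], of n] by (simp add: add.commute)
  ultimately show ?thesis
    by (rule LIMSEQ_unique[symmetric])
qed

lemma qpoch_le_1:
  assumes "0 < q" "q < 1" "0 < a" "a < 1"
  shows "qpoch a q n \<le> 1"
  unfolding qpoch_def using assms mult_power_less_one[OF assms]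
  by (intro prod_le_1) (auto simp: less_imp_le)

lemma qpoch_inf_le_qpoch:
  assumes "0 < q" "q < 1" "0 < a" "a < 1"
  shows "qpoch_inf a q \<le> qpoch a q n"
proof -
  have a: "0 < a * q ^ n" "a * q ^ n < 1"
    using assms by (auto intro: mult_power_less_one)
  have "qpoch_inf (a * q ^ n) q \<le> 1"
    using qpoch_LIMSEQ[OF assms(1,2) a] by (rule LIMSEQ_le_const2) (use qpoch_le_1[OF assms(1,2) a] in auto)
  then show ?thesis
    using qpoch_inf_split[OF assms, of n] qpoch_pos[OF assms, of n] by simp
qed

text \<open>In the factors of index \<open>k\<close>, right side minus left side is a q^k
  (1-u)(1-v).\<close>

lemma qpoch_inf_mult_le:
  assumes q: "0 < q" "q < 1" and a: "0 < a" "a < 1" and u: "0 < u" "u \<le> 1" and v: "0 < v" "v \<le> 1"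
  shows "qpoch_inf a q * qpoch_inf (a * u * v) q \<le> qpoch_inf (a * u) q * qpoch_inf (a * v) q"
proof -
  have le: "a * u \<le> a" "a * v \<le> a" "a * u * v \<le> a * u"
    using a u v by (simp_all add: mult_le_cancel_left1)
  have lt: "a * u < 1" "a * v < 1" "a * u * v < 1"
    using le a by linarith+
  have fac: "(1 - a * q ^ k) * (1 - a * u * v * q ^ k) \<le> (1 - a * u * q ^ k) * (1 - a * v * q ^ k)" for k
  proof -
    have "0 \<le> a * q ^ k * ((1 - u) * (1 - v))"
      using q a u v by simp
    then show ?thesis by (simp add: algebra_simps)
  qed
  have "qpoch a q n * qpoch (a * u * v) q n \<le> qpoch (a * u) q n * qpoch (a * v) q n" for n
    unfolding qpoch_def prod.distrib[symmetric]
  proof (intro prod_mono conjI fac)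
    fix k
    have "a * q ^ k < 1" "a * u * v * q ^ k < 1"
      using q a u v lt by (auto intro!: mult_power_less_one)
    then show "0 \<le> (1 - a * q ^ k) * (1 - a * u * v * q ^ k)" by simp
  qed
  then show ?thesis
    using q a u v lt
    by (intro LIMSEQ_le[of "\<lambda>n. qpoch a q n * qpoch (a * u * v) q n" _ "\<lambda>n. qpoch (a * u) q n * qpoch (a * v) q n"]
        tendsto_mult qpoch_LIMSEQ) auto
qed

text \<open>Strictness would be lost in the limit, so the factors of index 0 are split off and
  compared strictly, and the tails, with \<open>a * q\<close> for \<open>a\<close>, weakly.\<close>

lemma qpoch_inf_mult_less:
  assumes q: "0 < q" "q < 1" and a: "0 < a" "a < 1" and u: "0 < u" "u < 1" and v: "0 < v" "v < 1"
  shows "qpoch_inf a q * qpoch_inf (a * u * v) q < qpoch_inf (a * u) q * qpoch_inf (a * v) q"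
proof -
  have le: "a * u \<le> a" "a * v \<le> a" "a * u * v \<le> a * u" "a * q < 1"
    using a u v q mult_power_less_one[of q a 1] by (simp_all add: mult_le_cancel_left1)
  have lt: "a * u < 1" "a * v < 1" "a * u * v < 1"
    using le a by linarith+
  have split: "qpoch_inf b q = (1 - b) * qpoch_inf (b * q) q" if "0 < b" "b < 1" for b
    using qpoch_inf_split[OF q that, of 1] by (simp add: qpoch_def)
  have "0 < a * ((1 - u) * (1 - v))"
    using a u v by simp
  then have fac: "(1 - a) * (1 - a * u * v) < (1 - a * u) * (1 - a * v)"
    by (simp add: algebra_simps)
  have auvq: "a * u * v * q < 1" and pos: "a * u > 0" "a * v > 0" "a * u * v > 0"
    using q a u v lt mult_power_less_one[of q "a * u * v" 1] by auto
  have "qpoch_inf a q * qpoch_inf (a * u * v) q =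
      ((1 - a) * (1 - a * u * v)) * (qpoch_inf (a * q) q * qpoch_inf (a * u * v * q) q)"
    using split[of a] split[of "a * u * v"] pos a lt by simp
  also have "\<dots> < ((1 - a * u) * (1 - a * v)) * (qpoch_inf (a * q) q * qpoch_inf (a * u * v * q) q)"
    using fac q a u v le(4) pos auvq by (intro mult_strict_right_mono mult_pos_pos qpoch_inf_pos) auto
  also have "\<dots> \<le> ((1 - a * u) * (1 - a * v)) * (qpoch_inf (a * u * q) q * qpoch_inf (a * v * q) q)"
    using qpoch_inf_mult_le[OF q, of "a * q" u v] q a u v le lt
    by (intro mult_left_mono) (auto simp: mult_ac)
  also have "\<dots> = qpoch_inf (a * u) q * qpoch_inf (a * v) q"
    using split[of "a * u"] split[of "a * v"] pos a lt by simp
  finally show ?thesis .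
qed

section \<open>The q-gamma function and the coefficients behind the upper bounds\<close>

lemma powr_in_unit_interval:
  fixes q z :: real
  assumes "0 < q" "q < 1" "0 < z"
  shows "0 < q powr z" "q powr z < 1"
  using assms powr_less_mono2[of z q 1] by auto

lemma q_Gamma_pos:
  assumes "0 < q" "q < 1" "0 < z"
  shows "q_Gamma q z > 0"
  unfolding q_Gamma_def using assms powr_in_unit_interval[OF assms]
  by (intro mult_pos_pos divide_pos_pos qpoch_inf_pos) auto

text \<open>Iterated form of Gamma_q(z+1) = (1 - q^z)/(1 - q) Gamma_q(z).\<close>

lemma q_Gamma_add:
  assumes "0 < q" "q < 1" "0 < z"
  shows "q_Gamma q (z + real n) = q_Gamma q z * qpoch (q powr z) q n / (1 - q) ^ n"
proof -
  have "(1 - q) powr (1 - (z + real n)) = (1 - q) powr (1 - z) / (1 - q) ^ n"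
    using assms by (simp add: powr_diff powr_add powr_realpow)
  moreover have "q powr (z + real n) = q powr z * q ^ n"
    using assms by (simp add: powr_add powr_realpow)
  moreover have "qpoch_inf (q powr z) q = qpoch (q powr z) q n * qpoch_inf (q powr z * q ^ n) q"
    using assms by (intro qpoch_inf_split powr_in_unit_interval) auto
  moreover have "qpoch (q powr z) q n > 0"
    using assms by (intro qpoch_pos powr_in_unit_interval) auto
  ultimately show ?thesis
    unfolding q_Gamma_def by simp
qed

text \<open>The two pairs of arguments have equal sums, so the numerators agree and only the
  infinite products in the denominators remain to be compared.\<close>

lemma q_Gamma_mult_eq:
  assumes "0 < q" "q < 1"
  shows "q_Gamma q x * q_Gamma q (x + \<alpha> + \<beta>) = (1 - q) powr (2 - 2 * x - \<alpha> - \<beta>) * (qpoch_inf q q)\<^sup>2 /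
      (qpoch_inf (q powr x) q * qpoch_inf (q powr x * q powr \<alpha> * q powr \<beta>) q)"
    and "q_Gamma q (x + \<alpha>) * q_Gamma q (x + \<beta>) = (1 - q) powr (2 - 2 * x - \<alpha> - \<beta>) * (qpoch_inf q q)\<^sup>2 /
      (qpoch_inf (q powr x * q powr \<alpha>) q * qpoch_inf (q powr x * q powr \<beta>) q)"
proof -
  have prod: "(s * (Q / b)) * (t * (Q / c)) = (s * t) * Q\<^sup>2 / (b * c)" for s t Q b c :: real
    by (simp add: power2_eq_square)
  have "(1 - q) powr (1 - x) * (1 - q) powr (1 - (x + \<alpha> + \<beta>)) = (1 - q) powr (2 - 2 * x - \<alpha> - \<beta>)"
    "(1 - q) powr (1 - (x + \<alpha>)) * (1 - q) powr (1 - (x + \<beta>)) = (1 - q) powr (2 - 2 * x - \<alpha> - \<beta>)"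
    by (simp_all add: algebra_simps flip: powr_add)
  then show "q_Gamma q x * q_Gamma q (x + \<alpha> + \<beta>) = (1 - q) powr (2 - 2 * x - \<alpha> - \<beta>) * (qpoch_inf q q)\<^sup>2 /
      (qpoch_inf (q powr x) q * qpoch_inf (q powr x * q powr \<alpha> * q powr \<beta>) q)"
    "q_Gamma q (x + \<alpha>) * q_Gamma q (x + \<beta>) = (1 - q) powr (2 - 2 * x - \<alpha> - \<beta>) * (qpoch_inf q q)\<^sup>2 /
      (qpoch_inf (q powr x * q powr \<alpha>) q * qpoch_inf (q powr x * q powr \<beta>) q)"
    unfolding q_Gamma_def prod powr_add[of q] by (simp_all only:)
qed

lemma q_Gamma_mult_le:
  assumes "0 < q" "q < 1" "0 < x" "0 \<le> \<alpha>" "0 \<le> \<beta>"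
  shows "q_Gamma q (x + \<alpha>) * q_Gamma q (x + \<beta>) \<le> q_Gamma q x * q_Gamma q (x + \<alpha> + \<beta>)"
proof -
  have x: "0 < q powr x" "q powr x < 1"
    using assms by (auto intro: powr_in_unit_interval)
  have "q powr \<alpha> \<le> 1" "q powr \<beta> \<le> 1"
    using assms by (simp_all add: powr_le1)
  then have "qpoch_inf (q powr x) q * qpoch_inf (q powr x * q powr \<alpha> * q powr \<beta>) q \<le>
      qpoch_inf (q powr x * q powr \<alpha>) q * qpoch_inf (q powr x * q powr \<beta>) q"
    using assms x by (intro qpoch_inf_mult_le) auto
  moreover have "0 < qpoch_inf (q powr (x + s)) q" if "0 \<le> s" for s
    using assms that by (intro qpoch_inf_pos powr_in_unit_interval) auto
  from this[of 0] this[of \<alpha>] this[of \<beta>] this[of "\<alpha> + \<beta>"] assms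
  have "0 < qpoch_inf (q powr x) q" "0 < qpoch_inf (q powr x * q powr \<alpha> * q powr \<beta>) q"
    "0 < qpoch_inf (q powr x * q powr \<alpha>) q" "0 < qpoch_inf (q powr x * q powr \<beta>) q"
    by (auto simp: powr_add mult.assoc)
  ultimately show ?thesis
    unfolding q_Gamma_mult_eq[OF assms(1,2)] using assms by (intro divide_left_mono mult_pos_pos) auto
qed

lemma q_Gamma_mult_less:
  assumes "0 < q" "q < 1" "0 < x" "0 < \<alpha>" "0 < \<beta>"
  shows "q_Gamma q (x + \<alpha>) * q_Gamma q (x + \<beta>) < q_Gamma q x * q_Gamma q (x + \<alpha> + \<beta>)"
proof -
  note unit = powr_in_unit_interval[OF assms(1,2)]
  have "qpoch_inf (q powr x) q * qpoch_inf (q powr x * q powr \<alpha> * q powr \<beta>) q <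
      qpoch_inf (q powr x * q powr \<alpha>) q * qpoch_inf (q powr x * q powr \<beta>) q"
    using assms unit by (intro qpoch_inf_mult_less) auto
  moreover have "0 < qpoch_inf (q powr (x + s)) q" if "0 \<le> s" for s
    using assms that by (intro qpoch_inf_pos unit) auto
  from this[of 0] this[of \<alpha>] this[of \<beta>] this[of "\<alpha> + \<beta>"] assms
  have "0 < qpoch_inf (q powr x) q" "0 < qpoch_inf (q powr x * q powr \<alpha> * q powr \<beta>) q"
    "0 < qpoch_inf (q powr x * q powr \<alpha>) q" "0 < qpoch_inf (q powr x * q powr \<beta>) q"
    by (auto simp: powr_add mult.assoc)
  moreover have "qpoch_inf q q > 0"
    using assms by (intro qpoch_inf_pos) auto
  ultimately show ?thesis
    unfolding q_Gamma_mult_eq[OF assms(1,2)] using assms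
    by (intro divide_strict_left_mono mult_pos_pos) auto
qed

text \<open>From (C - A)(C - B) \<ge> 0 follows C(A + B) \<le> C^2 + AB \<le> C^2 + CD.\<close>

lemma add_le_add_of_mult_le:
  fixes A B C D :: real
  assumes "0 < C" "A \<le> C" "B \<le> C" "A * B \<le> C * D"
  shows "A + B \<le> C + D"
proof -
  have "0 \<le> (C - A) * (C - B)"
    using assms by simp
  with assms(4) have "C * (A + B) \<le> C * (C + D)"
    by (simp add: algebra_simps)
  with assms(1) show ?thesis by simp
qed

text \<open>For \<open>k \<le> l\<close> the first product on the right has the most widely spread
  arguments and dominates both products on the left. With a bound on the product of the two left
  terms, \<open>add_le_add_of_mult_le\<close> applies.\<close>

lemma q_Gamma_pair_le:
  assumes q: "0 < q" "q < 1" and pos: "0 < x" "0 < \<alpha>" "0 < \<beta>"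
  shows "q_Gamma q (x + \<alpha> + real k) * q_Gamma q (x + \<beta> + real l) +
      q_Gamma q (x + \<alpha> + real l) * q_Gamma q (x + \<beta> + real k) \<le>
    q_Gamma q (x + real k) * q_Gamma q (x + \<alpha> + \<beta> + real l) +
      q_Gamma q (x + real l) * q_Gamma q (x + \<alpha> + \<beta> + real k)"
proof (induction k l rule: linorder_wlog)
  case (le k l)
  let ?G = "q_Gamma q"
  define s where "s = real l - real k"
  define y where "y = x + real k"
  have s: "s \<ge> 0" and y: "y > 0"
    using le pos by (auto simp: s_def y_def)
  have eq: "x + \<alpha> + real k = y + \<alpha>" "x + \<beta> + real k = y + \<beta>" "x + \<alpha> + \<beta> + real k = y + \<alpha> + \<beta>"
    "x + \<alpha> + real l = y + s + \<alpha>" "x + \<beta> + real l = y + s + \<beta>" "x + \<alpha> + \<beta> + real l = y + s + \<alpha> + \<beta>"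
    "x + real k = y" "x + real l = y + s"
    by (simp_all add: s_def y_def)
  have G: "?G z > 0" if "z > 0" for z
    using q that by (rule q_Gamma_pos)
  have 1: "?G (y + \<alpha>) * ?G (y + s + \<beta>) \<le> ?G y * ?G (y + s + \<alpha> + \<beta>)"
    using q_Gamma_mult_le[OF q y, of \<alpha> "s + \<beta>"] pos s by (simp add: add_ac)
  have 2: "?G (y + s + \<alpha>) * ?G (y + \<beta>) \<le> ?G y * ?G (y + s + \<alpha> + \<beta>)"
    using q_Gamma_mult_le[OF q y, of "s + \<alpha>" \<beta>] pos s by (simp add: add_ac)
  \<comment> \<open>The inequality is taken at \<open>y\<close> and at \<open>y + s\<close>; the
    factors are then regrouped crosswise.\<close>
  have "(?G (y + \<alpha>) * ?G (y + \<beta>)) * (?G (y + s + \<alpha>) * ?G (y + s + \<beta>)) \<le>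
      (?G y * ?G (y + \<alpha> + \<beta>)) * (?G (y + s) * ?G (y + s + \<alpha> + \<beta>))"
    using pos y s q by (intro mult_mono q_Gamma_mult_le mult_nonneg_nonneg less_imp_le[OF G]) auto
  then have 3: "(?G (y + \<alpha>) * ?G (y + s + \<beta>)) * (?G (y + s + \<alpha>) * ?G (y + \<beta>)) \<le>
      (?G y * ?G (y + s + \<alpha> + \<beta>)) * (?G (y + s) * ?G (y + \<alpha> + \<beta>))"
    by (simp only: mult_ac)
  show ?case
    unfolding eq using 1 2 3 by (intro add_le_add_of_mult_le) (use G y s pos in auto)
next
  case (sym k l)
  then show ?case by (simp add: add_ac mult_ac)
qed

text \<open>\<open>E m\<close> will be the coefficient of \<open>x ^ m\<close> in minus
  \<open>Delta\<close>. Symmetrizing in \<open>k\<close> and \<open>m - k\<close> reduces its sign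
  to \<open>q_Gamma_pair_le\<close>; strictness comes from the diagonal term \<open>k = p\<close> of
  \<open>E (2 * p)\<close>.\<close>

lemma q_Gamma_convolution_diff_nonneg:
  assumes q: "0 < q" "q < 1" and pos: "0 < \<mu>" "0 < \<alpha>" "0 < \<beta>" and d: "\<And>n. d n \<ge> 0"
  defines "E \<equiv> \<lambda>m. \<Sum>k\<le>m. d k * d (m - k) *
      (q_Gamma q (\<mu> + real k) * q_Gamma q (\<mu> + \<alpha> + \<beta> + real (m - k)) -
       q_Gamma q (\<mu> + \<alpha> + real k) * q_Gamma q (\<mu> + \<beta> + real (m - k)))"
  shows "E m \<ge> 0" and "d p \<noteq> 0 \<Longrightarrow> E (2 * p) > 0"
proof -
  define T where "T k l = q_Gamma q (\<mu> + real k) * q_Gamma q (\<mu> + \<alpha> + \<beta> + real l) -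
      q_Gamma q (\<mu> + \<alpha> + real k) * q_Gamma q (\<mu> + \<beta> + real l)" for k l
  have T: "T k l + T l k \<ge> 0" for k l
    using q_Gamma_pair_le[OF q pos, of k l] by (simp add: T_def)
  have "E m = (\<Sum>k\<le>m. d k * d (m - k) * T k (m - k))" for m
    by (simp add: E_def T_def)
  moreover have "(\<Sum>k\<le>m. d k * d (m - k) * T k (m - k)) = (\<Sum>k\<le>m. d k * d (m - k) * T (m - k) k)" for m
    by (subst sum_atMost_rev[symmetric]) (simp add: mult_ac)
  ultimately have E: "2 * E m = (\<Sum>k\<le>m. d k * d (m - k) * (T k (m - k) + T (m - k) k))" for m
    by (simp add: distrib_left sum.distrib)
  have "2 * E m \<ge> 0"
    unfolding E by (intro sum_nonneg mult_nonneg_nonneg d T)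
  then show "E m \<ge> 0" by simp
  assume "d p \<noteq> 0"
  then have "d p > 0"
    using d[of p] by simp
  moreover have "T p p > 0"
    using q_Gamma_mult_less[OF q, of "\<mu> + real p" \<alpha> \<beta>] pos by (simp add: T_def add_ac)
  ultimately have "2 * E (2 * p) > 0"
    unfolding E by (intro sum_pos2[of _ p] mult_nonneg_nonneg d T) auto
  then show "E (2 * p) > 0" by simp
qed

section \<open>Convergence and positivity of the power series\<close>

lemma sums_power_series_prod_diff:
  fixes f g h j :: "nat \<Rightarrow> real"
  assumes "summable (\<lambda>n. \<bar>f n * x ^ n\<bar>)" "summable (\<lambda>n. \<bar>g n * x ^ n\<bar>)"
    "summable (\<lambda>n. \<bar>h n * x ^ n\<bar>)" "summable (\<lambda>n. \<bar>j n * x ^ n\<bar>)"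
  shows "(\<lambda>m. (\<Sum>k\<le>m. f k * g (m - k) - h k * j (m - k)) * x ^ m) sums
    ((\<Sum>n. f n * x ^ n) * (\<Sum>n. g n * x ^ n) - (\<Sum>n. h n * x ^ n) * (\<Sum>n. j n * x ^ n))"
proof -
  have prod: "(\<lambda>m. (\<Sum>k\<le>m. f k * g (m - k)) * x ^ m) sums ((\<Sum>n. f n * x ^ n) * (\<Sum>n. g n * x ^ n))"
    if "summable (\<lambda>n. \<bar>f n * x ^ n\<bar>)" "summable (\<lambda>n. \<bar>g n * x ^ n\<bar>)" for f g :: "nat \<Rightarrow> real"
  proof -
    have "(\<Sum>k\<le>m. f k * g (m - k)) * x ^ m = (\<Sum>k\<le>m. (f k * x ^ k) * (g (m - k) * x ^ (m - k)))" for m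
      unfolding sum_distrib_right
    proof (rule sum.cong[OF refl])
      fix k assume "k \<in> {..m}"
      then have "x ^ m = x ^ k * x ^ (m - k)"
        by (simp flip: power_add)
      then show "f k * g (m - k) * x ^ m = (f k * x ^ k) * (g (m - k) * x ^ (m - k))"
        by simp
    qed
    then show ?thesis
      using Cauchy_product_sums[of "\<lambda>n. f n * x ^ n" "\<lambda>n. g n * x ^ n"] that by simp
  qed
  show ?thesis
    using sums_diff[OF prod[OF assms(1,2)] prod[OF assms(3,4)]]
    by (simp add: sum_subtractf left_diff_distrib)
qed

lemma dser_0: "dser q d z 0 = d 0 * q_Gamma q z"
  using powser_zero[of "\<lambda>n. d n * q_Gamma q (z + real n)"] by (simp add: dser_def)

text \<open>The radius is given at \<mu>, but the series is needed at shifted parameters as well.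
  The shift costs only the constant factor \<open>C\<close>, since the shifted q-factorial is at
  most 1 and the one at \<mu> is at least its positive limit.\<close>

lemma summable_dser:
  assumes q: "0 < q" "q < 1" and "0 < \<mu>" "0 \<le> s" and x: "0 \<le> x" "ereal x < dser_radius q d \<mu>"
  shows "summable (\<lambda>n. \<bar>d n * q_Gamma q (\<mu> + s + real n) * x ^ n\<bar>)"
proof -
  define C where "C = q_Gamma q (\<mu> + s) / (q_Gamma q \<mu> * qpoch_inf (q powr \<mu>) q)"
  have G: "q_Gamma q z > 0" if "z > 0" for z
    using q that by (rule q_Gamma_pos)
  note unit = powr_in_unit_interval[OF q]
  have inf: "qpoch_inf (q powr \<mu>) q > 0"
    using q assms unit by (intro qpoch_inf_pos) auto
  have bound: "q_Gamma q (\<mu> + s + real n) \<le> C * q_Gamma q (\<mu> + real n)" for n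
  proof -
    have "qpoch (q powr (\<mu> + s)) q n \<le> 1"
      using assms unit by (intro qpoch_le_1) auto
    also have "1 \<le> qpoch (q powr \<mu>) q n / qpoch_inf (q powr \<mu>) q"
      using assms inf unit by (simp add: qpoch_inf_le_qpoch)
    finally have le: "q_Gamma q (\<mu> + s) * qpoch (q powr (\<mu> + s)) q n \<le>
        q_Gamma q (\<mu> + s) * (qpoch (q powr \<mu>) q n / qpoch_inf (q powr \<mu>) q)"
      using assms G by (intro mult_left_mono) (auto simp: less_imp_le)
    have "q_Gamma q (\<mu> + s + real n) \<le>
        q_Gamma q (\<mu> + s) * (qpoch (q powr \<mu>) q n / qpoch_inf (q powr \<mu>) q) / (1 - q) ^ n"
      using divide_right_mono[OF le, of "(1 - q) ^ n"] assms by (simp add: q_Gamma_add)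
    also have "\<dots> = C * q_Gamma q (\<mu> + real n)"
      using assms G[of \<mu>] by (simp add: C_def q_Gamma_add)
    finally show ?thesis .
  qed
  have "summable (\<lambda>n. norm (d n * q_Gamma q (\<mu> + real n) * x ^ n))"
    using x unfolding dser_radius_def by (intro abs_summable_in_conv_radius) simp
  then have "summable (\<lambda>n. C * \<bar>d n * q_Gamma q (\<mu> + real n) * x ^ n\<bar>)"
    by (intro summable_mult) simp
  then show ?thesis
  proof (rule summable_comparison_test'[where N = 0])
    fix n
    have "\<bar>d n\<bar> * q_Gamma q (\<mu> + s + real n) * \<bar>x ^ n\<bar> \<le>
        \<bar>d n\<bar> * (C * q_Gamma q (\<mu> + real n)) * \<bar>x ^ n\<bar>"
      by (intro mult_left_mono mult_right_mono bound) auto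
    then show "norm \<bar>d n * q_Gamma q (\<mu> + s + real n) * x ^ n\<bar> \<le>
        C * \<bar>d n * q_Gamma q (\<mu> + real n) * x ^ n\<bar>"
      using assms G[of "\<mu> + s + real n"] G[of "\<mu> + real n"]
      by (simp add: abs_mult mult_ac)
  qed
qed

lemma dser_pos:
  assumes "0 < q" "q < 1" "0 < \<mu>" "0 \<le> s" "0 \<le> x" "ereal x < dser_radius q d \<mu>"
    and d: "\<And>n. d n \<ge> 0" "d p \<noteq> 0" "quot_defined d x"
  shows "dser q d (\<mu> + s) x > 0"
proof -
  have G: "q_Gamma q (\<mu> + s + real n) > 0" for n
    using assms by (intro q_Gamma_pos) auto
  \<comment> \<open>At \<open>x = 0\<close> only the term of index 0 survives, and
    \<open>quot_defined\<close> makes it positive.\<close>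
  obtain r where r: "d r > 0" "x ^ r > 0"
  proof (cases "x = 0")
    case True
    then have "d 0 > 0"
      using d(3) d(1)[of 0] by (simp add: quot_defined_def)
    then show ?thesis using that[of 0] by simp
  next
    case False
    then show ?thesis using that[of p] assms d(1)[of p] by simp
  qed
  have "0 < (\<Sum>n. d n * q_Gamma q (\<mu> + s + real n) * x ^ n)"
    using summable_rabs_cancel[OF summable_dser[OF assms(1-6)]] r assms G
    by (intro suminf_pos2[of _ r]) (auto intro!: mult_nonneg_nonneg d simp: less_imp_le)
  then show ?thesis by (simp add: dser_def)
qed

section \<open>Bounds for the products of two series\<close>

lemma Delta_upper:
  assumes q: "0 < q" "q < 1" and pos: "0 < \<mu>" "0 < \<alpha>" "0 < \<beta>"
    and x: "0 \<le> x" "ereal x < dser_radius q d \<mu>" and d: "\<And>n. d n \<ge> 0"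
  shows "Delta q d \<mu> \<alpha> \<beta> x \<le> upper_B q d \<mu> \<alpha> \<beta>"
    and "0 < x \<Longrightarrow> nonconstant d \<Longrightarrow> Delta q d \<mu> \<alpha> \<beta> x < upper_B q d \<mu> \<alpha> \<beta>"
proof -
  define E where "E m = (\<Sum>k\<le>m. d k * d (m - k) *
      (q_Gamma q (\<mu> + real k) * q_Gamma q (\<mu> + \<alpha> + \<beta> + real (m - k)) -
       q_Gamma q (\<mu> + \<alpha> + real k) * q_Gamma q (\<mu> + \<beta> + real (m - k))))" for m
  note S = summable_dser[OF q pos(1) _ x]
  have "(\<lambda>m. E m * x ^ m) sums (- Delta q d \<mu> \<alpha> \<beta> x)"
    using sums_power_series_prod_diff[OF S[of 0] S[of "\<alpha> + \<beta>"] S[of \<alpha>] S[of \<beta>]] pos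
    by (simp add: Delta_def dser_def E_def algebra_simps)
  moreover have "E 0 * x ^ 0 = - upper_B q d \<mu> \<alpha> \<beta>"
    by (simp add: E_def upper_B_def power2_eq_square algebra_simps)
  \<comment> \<open>Moving the constant term across leaves the gap between bound and
    \<open>Delta\<close> as a series of nonnegative terms.\<close>
  ultimately have sums: "(\<lambda>m. E (Suc m) * x ^ Suc m) sums (upper_B q d \<mu> \<alpha> \<beta> - Delta q d \<mu> \<alpha> \<beta> x)"
    by (subst sums_Suc_iff) simp
  have nonneg: "E m * x ^ m \<ge> 0" for m
    unfolding E_def using q_Gamma_convolution_diff_nonneg(1)[where d = d, OF q pos d] x by simp
  show "Delta q d \<mu> \<alpha> \<beta> x \<le> upper_B q d \<mu> \<alpha> \<beta>"
    using sums_le[OF nonneg sums_zero sums] by simp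
  assume "0 < x" "nonconstant d"
  then obtain p where p: "p \<ge> 1" "d p \<noteq> 0"
    by (auto simp: nonconstant_def)
  have "E (2 * p) > 0"
    unfolding E_def using q_Gamma_convolution_diff_nonneg(2)[where d = d, OF q pos d p(2)] .
  \<comment> \<open>Coefficient \<open>2 * p\<close> sits at position \<open>2 * p - 1\<close> of
    the shifted series; \<open>p \<ge> 1\<close> keeps it off the removed constant term.\<close>
  then have "0 < E (Suc (2 * p - 1)) * x ^ Suc (2 * p - 1)"
    using p \<open>0 < x\<close> by simp
  then have "0 < (\<Sum>m. E (Suc m) * x ^ Suc m)"
    using sums_summable[OF sums] nonneg by (intro suminf_pos2[of _ "2 * p - 1"])
  then show "Delta q d \<mu> \<alpha> \<beta> x < upper_B q d \<mu> \<alpha> \<beta>"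
    using sums_unique[OF sums] by simp
qed

text \<open>Either \<open>d 0 \<noteq> 0\<close> and the upper bound is itself negative, or the
  bound is 0 and is strict because \<open>quot_defined\<close> forces \<open>x > 0\<close>.\<close>

lemma Delta_neg:
  assumes q: "0 < q" "q < 1" and pos: "0 < \<mu>" "0 < \<alpha>" "0 < \<beta>"
    and x: "0 \<le> x" "ereal x < dser_radius q d \<mu>" and d: "\<And>n. d n \<ge> 0" "d p \<noteq> 0" "quot_defined d x"
  shows "Delta q d \<mu> \<alpha> \<beta> x < 0"
proof (cases "d 0 = 0")
  case False
  then have "upper_B q d \<mu> \<alpha> \<beta> < 0"
    unfolding upper_B_def using q_Gamma_mult_less[OF q pos] by (intro mult_pos_neg) auto
  with Delta_upper(1)[OF q pos x d(1)] show ?thesis by simp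
next
  case True
  then have "nonconstant d" "x > 0"
    using d(2,3) by (auto simp: nonconstant_def quot_defined_def Suc_le_eq intro!: exI[of _ p] gr0I)
  with Delta_upper(2)[OF q pos x d(1)] True show ?thesis
    by (simp add: upper_B_def)
qed

lemma dser_mult_lower:
  assumes q: "0 < q" "q < 1" and pos: "0 < \<mu>" "0 < \<alpha>" "0 < \<beta>"
    and x: "0 \<le> x" "ereal x < dser_radius q d \<mu>" and d: "doubly_positive (\<lambda>n. d n * qpoch q q n)"
  shows "Gamma_quot q \<mu> \<alpha> \<beta> * (dser q d \<mu> x * dser q d (\<mu> + \<alpha> + \<beta>) x) \<le>
      dser q d (\<mu> + \<alpha>) x * dser q d (\<mu> + \<beta>) x"
    and "0 < x \<Longrightarrow> nonconstant d \<Longrightarrow>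
      Gamma_quot q \<mu> \<alpha> \<beta> * (dser q d \<mu> x * dser q d (\<mu> + \<alpha> + \<beta>) x) <
      dser q d (\<mu> + \<alpha>) x * dser q d (\<mu> + \<beta>) x"
proof -
  define e where "e n = d n * qpoch q q n" for n
  define y where "y = x / (1 - q)"
  define F where "F s = (\<Sum>n. e n * qcoeff q (q powr (\<mu> + s)) n * y ^ n)" for s
  note unit = powr_in_unit_interval[OF q]
  have e: "doubly_positive e"
    using d by (simp add: e_def[abs_def])
  have G: "q_Gamma q (\<mu> + s) > 0" if "s \<ge> 0" for s
    using q pos that by (intro q_Gamma_pos) auto
  have qq: "qpoch q q n > 0" for n
    using q by (simp add: qpoch_pos)
  \<comment> \<open>The powers of \<open>1 - q\<close> from \<open>q_Gamma_add\<close> go into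
    \<open>y\<close>, and \<open>qpoch q q n\<close> cancels between \<open>e\<close> and
    \<open>qcoeff\<close>.\<close>
  have dser_term: "d n * q_Gamma q (\<mu> + s + real n) * x ^ n =
      q_Gamma q (\<mu> + s) * (e n * qcoeff q (q powr (\<mu> + s)) n * y ^ n)" if "s \<ge> 0" for s n
    using q_Gamma_add[OF q, of "\<mu> + s" n] pos that qq[of n]
    by (simp add: e_def y_def qcoeff_def power_divide)
  have summ: "summable (\<lambda>n. \<bar>e n * qcoeff q (q powr (\<mu> + s)) n * y ^ n\<bar>)" if "s \<ge> 0" for s
    using summable_dser[OF q pos(1) that x] G[OF that]
    unfolding dser_term[OF that] abs_mult[of "q_Gamma q (\<mu> + s)"]
    by (subst (asm) summable_cmult_iff) auto
  have dser: "dser q d (\<mu> + s) x = q_Gamma q (\<mu> + s) * F s" if "s \<ge> 0" for s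
    unfolding dser_def F_def dser_term[OF that]
    by (rule suminf_mult[OF summable_rabs_cancel[OF summ[OF that]]])
  define C where "C m = (\<Sum>k\<le>m. e k * e (m - k) *
      (qcoeff q (q powr \<mu> * q powr \<alpha>) k * qcoeff q (q powr \<mu> * q powr \<beta>) (m - k)
        - qcoeff q (q powr \<mu>) k * qcoeff q (q powr \<mu> * q powr \<alpha> * q powr \<beta>) (m - k)))" for m
  have sums: "(\<lambda>m. C m * y ^ m) sums (F \<alpha> * F \<beta> - F 0 * F (\<alpha> + \<beta>))"
    using sums_power_series_prod_diff[OF summ[of \<alpha>] summ[of \<beta>] summ[of 0] summ[of "\<alpha> + \<beta>"]] pos
    by (simp add: F_def C_def powr_add algebra_simps)
  have y: "y \<ge> 0"
    using x q by (simp add: y_def)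
  note conv = qcoeff_convolution_diff_nonneg[OF q unit[OF pos(1)] unit[OF pos(2)] unit[OF pos(3)] e]
  have nonneg: "C m * y ^ m \<ge> 0" for m
    unfolding C_def using conv(1)[of m] y by simp
  \<comment> \<open>\<open>Gamma_quot\<close> exchanges the gamma prefactors for those of the other
    product, so only the series \<open>F\<close> remain to be compared.\<close>
  have quot: "Gamma_quot q \<mu> \<alpha> \<beta> * (dser q d \<mu> x * dser q d (\<mu> + \<alpha> + \<beta>) x) =
      q_Gamma q (\<mu> + \<alpha>) * q_Gamma q (\<mu> + \<beta>) * (F 0 * F (\<alpha> + \<beta>))"
    using dser[of 0] dser[of "\<alpha> + \<beta>"] G[of 0] G[of "\<alpha> + \<beta>"] pos
    by (simp add: Gamma_quot_def add.assoc)
  have prod: "dser q d (\<mu> + \<alpha>) x * dser q d (\<mu> + \<beta>) x =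
      q_Gamma q (\<mu> + \<alpha>) * q_Gamma q (\<mu> + \<beta>) * (F \<alpha> * F \<beta>)"
    using dser[of \<alpha>] dser[of \<beta>] pos by simp
  have "F 0 * F (\<alpha> + \<beta>) \<le> F \<alpha> * F \<beta>"
    using sums_le[OF nonneg sums_zero sums] by simp
  then show "Gamma_quot q \<mu> \<alpha> \<beta> * (dser q d \<mu> x * dser q d (\<mu> + \<alpha> + \<beta>) x) \<le>
      dser q d (\<mu> + \<alpha>) x * dser q d (\<mu> + \<beta>) x"
    unfolding quot prod using G[of \<alpha>] G[of \<beta>] pos by (intro mult_left_mono) auto
  assume "0 < x" "nonconstant d"
  then obtain p where p: "p \<ge> 1" "d p \<noteq> 0"
    by (auto simp: nonconstant_def)
  then have "e p \<noteq> 0"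
    using qq[of p] by (simp add: e_def)
  then have "C (2 * p) * y ^ (2 * p) > 0"
    unfolding C_def using conv(2)[OF p(1)] \<open>0 < x\<close> q by (intro mult_pos_pos) (auto simp: y_def)
  then have "0 < (\<Sum>m. C m * y ^ m)"
    using sums_summable[OF sums] nonneg by (intro suminf_pos2[of _ "2 * p"])
  then have "F 0 * F (\<alpha> + \<beta>) < F \<alpha> * F \<beta>"
    using sums_unique[OF sums] by simp
  then show "Gamma_quot q \<mu> \<alpha> \<beta> * (dser q d \<mu> x * dser q d (\<mu> + \<alpha> + \<beta>) x) <
      dser q d (\<mu> + \<alpha>) x * dser q d (\<mu> + \<beta>) x"
    unfolding quot prod using G[of \<alpha>] G[of \<beta>] pos by (intro mult_strict_left_mono) auto
qed

section \<open>Combination of the estimates and the cases of equality\<close>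

theorem corollary2p2:
  fixes q \<mu> \<alpha> \<beta> x :: real and d :: "nat \<Rightarrow> real"
  assumes "0 < q" and "q < 1"
    and "\<mu> > 0" and "\<alpha> > 0" and "\<beta> > 0"
    and "dser_radius q d \<mu> > 0"
    and "0 \<le> x" and "ereal x < dser_radius q d \<mu>"
  shows "(doubly_positive (\<lambda>n. d n * qpoch q q n) \<longrightarrow>
            (quot_defined d x \<longrightarrow>
               Gamma_quot q \<mu> \<alpha> \<beta> \<le> dser_quot q d \<mu> \<alpha> \<beta> x \<and> dser_quot q d \<mu> \<alpha> \<beta> x < 1) \<and>
            lower_B q d \<mu> \<alpha> \<beta> x \<le> Delta q d \<mu> \<alpha> \<beta> x \<and>
            Delta q d \<mu> \<alpha> \<beta> x \<le> upper_B q d \<mu> \<alpha> \<beta> \<and>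
            (nonconstant d \<longrightarrow>
               (quot_defined d x \<longrightarrow>
                  (Gamma_quot q \<mu> \<alpha> \<beta> = dser_quot q d \<mu> \<alpha> \<beta> x \<longleftrightarrow> x = 0)) \<and>
               (lower_B q d \<mu> \<alpha> \<beta> x = Delta q d \<mu> \<alpha> \<beta> x \<longleftrightarrow> x = 0) \<and>
               (Delta q d \<mu> \<alpha> \<beta> x = upper_B q d \<mu> \<alpha> \<beta> \<longleftrightarrow> x = 0)))
       \<and> ((\<forall>n. d n \<ge> 0) \<longrightarrow>
            ((\<exists>n. d n \<noteq> 0) \<and> quot_defined d x \<longrightarrow> dser_quot q d \<mu> \<alpha> \<beta> x < 1) \<and>
            Delta q d \<mu> \<alpha> \<beta> x \<le> upper_B q d \<mu> \<alpha> \<beta> \<and>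
            (nonconstant d \<longrightarrow> (Delta q d \<mu> \<alpha> \<beta> x = upper_B q d \<mu> \<alpha> \<beta> \<longleftrightarrow> x = 0)))"
proof -
  note q = assms(1,2) and pos = assms(3-5) and x = assms(7,8)
  have G: "q_Gamma q \<mu> > 0" "q_Gamma q (\<mu> + \<alpha> + \<beta>) > 0"
    using q pos by (auto intro!: q_Gamma_pos)
  \<comment> \<open>At \<open>x = 0\<close> each series is its constant term; in the quotient
    \<open>(d 0)\<^sup>2\<close> cancels, which needs \<open>d 0 \<noteq> 0\<close>.\<close>
  have x0: "Delta q d \<mu> \<alpha> \<beta> x = upper_B q d \<mu> \<alpha> \<beta>" "lower_B q d \<mu> \<alpha> \<beta> x = Delta q d \<mu> \<alpha> \<beta> x"
    "quot_defined d x \<Longrightarrow> Gamma_quot q \<mu> \<alpha> \<beta> = dser_quot q d \<mu> \<alpha> \<beta> x" if "x = 0"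
    using that G by (auto simp: Delta_def upper_B_def lower_B_def Gamma_quot_def dser_quot_def
        quot_defined_def dser_0 power2_eq_square field_simps)
  have D: "dser q d \<mu> x * dser q d (\<mu> + \<alpha> + \<beta>) x > 0"
    if "\<And>n. d n \<ge> 0" "d p \<noteq> 0" "quot_defined d x" for p
    using dser_pos[OF q pos(1) _ x that, of 0] dser_pos[OF q pos(1) _ x that, of "\<alpha> + \<beta>"] pos
    by (simp add: add.assoc)
  \<comment> \<open>In this form the lower bound in (B) is \<open>dser_mult_lower\<close> with the
    same product subtracted on both sides; (A) arises by dividing by that product.\<close>
  have lower: "lower_B q d \<mu> \<alpha> \<beta> x = Gamma_quot q \<mu> \<alpha> \<beta> * (dser q d \<mu> x * dser q d (\<mu> + \<alpha> + \<beta>) x)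
      - dser q d \<mu> x * dser q d (\<mu> + \<alpha> + \<beta>) x"
    by (simp add: lower_B_def algebra_simps)
  have upper: "((\<exists>n. d n \<noteq> 0) \<and> quot_defined d x \<longrightarrow> dser_quot q d \<mu> \<alpha> \<beta> x < 1) \<and>
      Delta q d \<mu> \<alpha> \<beta> x \<le> upper_B q d \<mu> \<alpha> \<beta> \<and>
      (nonconstant d \<longrightarrow> (Delta q d \<mu> \<alpha> \<beta> x = upper_B q d \<mu> \<alpha> \<beta> \<longleftrightarrow> x = 0))"
    if d: "\<And>n. d n \<ge> 0"
  proof (intro conjI impI)
    assume "(\<exists>n. d n \<noteq> 0) \<and> quot_defined d x"
    then obtain p where p: "d p \<noteq> 0" "quot_defined d x" by blast
    show "dser_quot q d \<mu> \<alpha> \<beta> x < 1"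
      using Delta_neg[OF q pos x d p] D[OF d p]
      by (simp add: dser_quot_def Delta_def divide_less_eq)
  next
    assume "nonconstant d"
    then show "Delta q d \<mu> \<alpha> \<beta> x = upper_B q d \<mu> \<alpha> \<beta> \<longleftrightarrow> x = 0"
      using Delta_upper(2)[OF q pos x d] x0(1) x(1) by fastforce
  qed (rule Delta_upper(1)[OF q pos x d])
  moreover have "(quot_defined d x \<longrightarrow>
        Gamma_quot q \<mu> \<alpha> \<beta> \<le> dser_quot q d \<mu> \<alpha> \<beta> x) \<and>
      lower_B q d \<mu> \<alpha> \<beta> x \<le> Delta q d \<mu> \<alpha> \<beta> x \<and>
      (nonconstant d \<longrightarrow>
         (quot_defined d x \<longrightarrow> (Gamma_quot q \<mu> \<alpha> \<beta> = dser_quot q d \<mu> \<alpha> \<beta> x \<longleftrightarrow> x = 0)) \<and>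
         (lower_B q d \<mu> \<alpha> \<beta> x = Delta q d \<mu> \<alpha> \<beta> x \<longleftrightarrow> x = 0))"
    and "(\<forall>n. d n \<ge> 0) \<and> (\<exists>n. d n \<noteq> 0)"
    if dp: "doubly_positive (\<lambda>n. d n * qpoch q q n)"
  proof -
    have "qpoch q q n > 0" for n
      using q by (simp add: qpoch_pos)
    then have d: "d n \<ge> 0" and ex: "\<exists>n. d n \<noteq> 0" for n
      using dp by (auto simp: doubly_positive_def zero_le_mult_iff not_le[symmetric])
    then show "(\<forall>n. d n \<ge> 0) \<and> (\<exists>n. d n \<noteq> 0)" by blast
    from ex obtain p where p: "d p \<noteq> 0" by blast
    note le = dser_mult_lower(1)[OF q pos x dp] and less = dser_mult_lower(2)[OF q pos x dp]
    show "(quot_defined d x \<longrightarrow>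
        Gamma_quot q \<mu> \<alpha> \<beta> \<le> dser_quot q d \<mu> \<alpha> \<beta> x) \<and>
      lower_B q d \<mu> \<alpha> \<beta> x \<le> Delta q d \<mu> \<alpha> \<beta> x \<and>
      (nonconstant d \<longrightarrow>
         (quot_defined d x \<longrightarrow> (Gamma_quot q \<mu> \<alpha> \<beta> = dser_quot q d \<mu> \<alpha> \<beta> x \<longleftrightarrow> x = 0)) \<and>
         (lower_B q d \<mu> \<alpha> \<beta> x = Delta q d \<mu> \<alpha> \<beta> x \<longleftrightarrow> x = 0))"
    proof (intro conjI impI)
      assume "quot_defined d x"
      then show "Gamma_quot q \<mu> \<alpha> \<beta> \<le> dser_quot q d \<mu> \<alpha> \<beta> x"
        using le D[OF d p] by (simp add: dser_quot_def pos_le_divide_eq)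
    next
      show "lower_B q d \<mu> \<alpha> \<beta> x \<le> Delta q d \<mu> \<alpha> \<beta> x"
        using le by (simp add: lower Delta_def)
    next
      assume nc: "nonconstant d" and qd: "quot_defined d x"
      have "Gamma_quot q \<mu> \<alpha> \<beta> < dser_quot q d \<mu> \<alpha> \<beta> x" if "x > 0"
        using less[OF that nc] D[OF d p qd] by (simp add: dser_quot_def pos_less_divide_eq)
      then show "Gamma_quot q \<mu> \<alpha> \<beta> = dser_quot q d \<mu> \<alpha> \<beta> x \<longleftrightarrow> x = 0"
        using x0(3) qd x(1) by fastforce
    next
      assume nc: "nonconstant d"
      have "lower_B q d \<mu> \<alpha> \<beta> x < Delta q d \<mu> \<alpha> \<beta> x" if "x > 0"
        using less[OF that nc] by (simp add: lower Delta_def)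
      then show "lower_B q d \<mu> \<alpha> \<beta> x = Delta q d \<mu> \<alpha> \<beta> x \<longleftrightarrow> x = 0"
        using x0(2) x(1) by fastforce
    qed
  qed
  ultimately show ?thesis by blast
qed

end
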